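(* Let $n$ and $k$ be integers with $n\ge k\ge 3$. Then $mc_k(K_{k,n})\le \lfloor \frac{k}{2}\rfloor$.
   Context: $K_{k,n}$ is the complete bipartite graph with parts of sizes $k$ and $n$. An edge-coloring assigns to each edge a color, where adjacent edges may receive the same color. A path is monochromatic if all its edges have the same color. For a $k$-edge-connected graph $G$, an $MC_k$-coloring of $G$ is an edge-coloring such that every two distinct vertices of $G$ are connected by at least $k$ pairwise edge-disjoint monochromatic paths (different paths may have different colors). The number $mc_k(G)$ is the maximum number of colors actually used by an $MC_k$-coloring of $G$. *)

theory Defs
  imports "Graph_Theory.Graph_Theory"
begin

text \<open>
  A finite simple graph is a symmetric digraph (locale \<^locale>\<open>graph\<close>), in which each undirected
  edge is represented by a pair of opposite arcs. Colourings and edge-disjointness concern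
  undirected edges, so these are taken to be the two-element sets \<open>{u, v}\<close>: the arcs \<open>(u, v)\<close> and
  \<open>(v, u)\<close> have the same colour, and two paths traversing them are not edge-disjoint.
\<close>

definition uedges :: "('a, 'b) pre_digraph \<Rightarrow> 'a set set" where
  "uedges G = {{u, v} | u v. (u, v) \<in> arcs_ends G}"

definition path_edges :: "'a vwalk \<Rightarrow> 'a set set" where
  "path_edges p = {{x, y} | x y. (x, y) \<in> set (vwalk_arcs p)}"

definition path_between :: "('a, 'b) pre_digraph \<Rightarrow> 'a \<Rightarrow> 'a vwalk \<Rightarrow> 'a \<Rightarrow> bool" where
  "path_between G u p v \<longleftrightarrow> vpath p G \<and> hd p = u \<and> last p = v"

definition monochromatic :: "('a set \<Rightarrow> nat) \<Rightarrow> 'a vwalk \<Rightarrow> bool" where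
  "monochromatic f p \<longleftrightarrow> (\<exists>c. \<forall>e \<in> path_edges p. f e = c)"

text \<open>
  Only the values of the colouring \<open>f\<close> on \<open>uedges G\<close> matter, and since the graphs are finite the
  natural numbers provide enough colours.
\<close>

definition MC_coloring :: "nat \<Rightarrow> ('a, 'b) pre_digraph \<Rightarrow> ('a set \<Rightarrow> nat) \<Rightarrow> bool" where
  "MC_coloring k G f \<longleftrightarrow>
    (\<forall>u \<in> verts G. \<forall>v \<in> verts G. u \<noteq> v \<longrightarrow>
      (\<exists>P. finite P \<and> card P \<ge> k \<and>
        (\<forall>p \<in> P. path_between G u p v \<and> monochromatic f p) \<and>
        pairwise (\<lambda>p q. disjnt (path_edges p) (path_edges q)) P))"

text \<open>
  For a \<open>k\<close>-edge-connected \<open>G\<close> the set below is nonempty: by Menger's theorem it is witnessed by a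
  constant colouring. If \<open>G\<close> has no such colouring, \<open>mc k G\<close> is the unspecified value \<open>Max {}\<close>.
\<close>

definition mc :: "nat \<Rightarrow> ('a, 'b) pre_digraph \<Rightarrow> nat" where
  "mc k G = Max {card (f ` uedges G) | f. MC_coloring k G f}"

end

theory Submission
  imports Defs
begin

text \<open>
  Every vertex on the side of size \<open>n\<close> has degree \<open>k\<close>, so the \<open>k\<close> monochromatic paths joining two
  such vertices use every edge at either end exactly once. Hence each colour has the same degree
  \<open>d\<close> at all vertices of that side. If \<open>d = 1\<close>, the colour class is a full star centred at some
  vertex \<open>a\<close> of the other side, all edges at \<open>a\<close> have this colour, and no monochromatic path leads
  from \<open>a\<close> to a further vertex of its side. So every colour occurs at least twice among the \<open>k\<close>
  edges at a vertex.
\<close>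

section \<open>Monochromatic paths counted by the edges at their ends, in an arbitrary graph\<close>

definition incident_edges :: "('a, 'b) pre_digraph \<Rightarrow> 'a \<Rightarrow> 'a set set" where
  "incident_edges G v = {e \<in> uedges G. v \<in> e}"

lemma path_edges_Nil [simp]: "path_edges [] = {}"
  and path_edges_singleton [simp]: "path_edges [x] = {}"
  and path_edges_Cons_Cons [simp]:
    "path_edges (x # y # p) = insert {x, y} (path_edges (y # p))"
  by (auto simp: path_edges_def)

lemma path_edges_rev [simp]: "path_edges (rev p) = path_edges p"
  by (auto simp: path_edges_def set_vwalk_arcs_rev)

lemma path_edges_hits_hd:
  assumes "p \<noteq> []" "hd p \<noteq> last p"
  shows "\<exists>e \<in> path_edges p. hd p \<in> e"
  using assms by (cases p rule: vwalk_arcs.cases) auto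

lemma path_edges_hits_last:
  assumes "p \<noteq> []" "hd p \<noteq> last p"
  shows "\<exists>e \<in> path_edges p. last p \<in> e"
  using assms
proof (induction p rule: vwalk_arcs.induct)
  case (3 x y p)
  then show ?case by (cases "y = last (y # p)") auto
qed auto

lemma path_edges_subset_uedges: "vwalk p G \<Longrightarrow> path_edges p \<subseteq> uedges G"
  by (auto simp: path_edges_def uedges_def vwalk_def)

text \<open>Edge-disjoint paths meet an end vertex in different edges, so a family of such paths can
  be counted by edges at either end.\<close>

lemma path_between_hits_ends:
  assumes "path_between G u p v" "u \<noteq> v"
  shows "\<exists>e \<in> incident_edges G u. e \<in> path_edges p"
    and "\<exists>e \<in> incident_edges G v. e \<in> path_edges p"
proof -
  have p: "p \<noteq> []" "hd p = u" "last p = v" "path_edges p \<subseteq> uedges G"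
    using assms path_edges_subset_uedges by (auto simp: path_between_def vpath_def vwalk_def)
  show "\<exists>e \<in> incident_edges G u. e \<in> path_edges p"
    using path_edges_hits_hd[of p] p assms(2) by (auto simp: incident_edges_def)
  show "\<exists>e \<in> incident_edges G v. e \<in> path_edges p"
    using path_edges_hits_last[of p] p assms(2) by (auto simp: incident_edges_def)
qed

text \<open>If the degree of \<open>u\<close> is at most \<open>k\<close>, the \<open>k\<close> paths out of \<open>u\<close> use up all edges at \<open>u\<close>.\<close>

lemma MC_coloring_low_degree:
  assumes MC: "MC_coloring k G f" and uv: "u \<in> verts G" "v \<in> verts G" "u \<noteq> v"
    and deg: "finite (incident_edges G u)" "card (incident_edges G u) \<le> k"
  obtains Q where "\<And>e. e \<in> incident_edges G u \<Longrightarrow> path_between G u (Q e) v"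
    and "\<And>e. e \<in> incident_edges G u \<Longrightarrow> \<forall>e' \<in> path_edges (Q e). f e' = f e"
    and "\<And>e e'. e \<in> incident_edges G u \<Longrightarrow> e' \<in> incident_edges G u \<Longrightarrow> e \<noteq> e' \<Longrightarrow>
      disjnt (path_edges (Q e)) (path_edges (Q e'))"
proof -
  obtain P where P: "finite P" "card P \<ge> k"
      "\<And>p. p \<in> P \<Longrightarrow> path_between G u p v" "\<And>p. p \<in> P \<Longrightarrow> monochromatic f p"
      "pairwise (\<lambda>p q. disjnt (path_edges p) (path_edges q)) P"
    using MC uv unfolding MC_coloring_def by (metis (no_types, lifting))
  have "\<forall>p \<in> P. \<exists>e. e \<in> incident_edges G u \<and> e \<in> path_edges p"
    using P(3) uv(3) path_between_hits_ends(1) by metis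
  then obtain F where F: "\<And>p. p \<in> P \<Longrightarrow> F p \<in> incident_edges G u"
      "\<And>p. p \<in> P \<Longrightarrow> F p \<in> path_edges p"
    by metis
  have inj: "inj_on F P"
  proof (rule inj_onI)
    fix p q assume "p \<in> P" "q \<in> P" "F p = F q"
    then show "p = q"
      using P(5) F(2)[of p] F(2)[of q] by (auto simp: pairwise_def disjnt_def)
  qed
  \<comment> \<open>Injectivity gives \<open>F\<close> at least \<open>k\<close> values, inside a
    set of at most \<open>k\<close> edges, so \<open>F\<close> is onto. Its inverse \<open>Q\<close>
    then indexes the paths by edges at \<open>u\<close>.\<close>
  have "F ` P = incident_edges G u"
  proof (rule card_seteq)
    show "card (incident_edges G u) \<le> card (F ` P)"
      using card_image[OF inj] deg(2) P(2) by simp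
  qed (use deg(1) F(1) in auto)
  then have bij: "bij_betw F P (incident_edges G u)"
    using inj by (simp add: bij_betw_def)
  define Q where "Q = inv_into P F"
  have QP: "Q e \<in> P" and FQ: "F (Q e) = e" if "e \<in> incident_edges G u" for e
    using bij that by (auto simp: Q_def bij_betw_def inv_into_into f_inv_into_f)
  show thesis
  proof
    fix e assume e: "e \<in> incident_edges G u"
    show "path_between G u (Q e) v" using P(3) QP e by blast
    \<comment> \<open>The path \<open>Q e\<close> contains its index \<open>e\<close>, so its single
      colour is \<open>f e\<close>.\<close>
    have "e \<in> path_edges (Q e)" using F(2) QP FQ e by metis
    then show "\<forall>e' \<in> path_edges (Q e). f e' = f e"
      using P(4)[OF QP[OF e]] by (auto simp: monochromatic_def)
    fix e' assume e': "e' \<in> incident_edges G u" "e \<noteq> e'"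
    then have "Q e \<noteq> Q e'" using FQ e by metis
    then show "disjnt (path_edges (Q e)) (path_edges (Q e'))"
      using P(5) QP e e' by (auto simp: pairwise_def)
  qed
qed

text \<open>The path indexed by an edge of colour \<open>c\<close> at \<open>u\<close> keeps this
  colour and so enters \<open>v\<close> by an edge of colour \<open>c\<close>. Disjoint paths enter
  by different edges, which makes \<open>L\<close> injective. If both degrees are at most
  \<open>k\<close>, exchanging \<open>u\<close> and \<open>v\<close> gives equality.\<close>

lemma MC_coloring_color_degree_le:
  assumes MC: "MC_coloring k G f" and uv: "u \<in> verts G" "v \<in> verts G"
    and deg: "finite (incident_edges G u)" "card (incident_edges G u) \<le> k"
    and fin: "finite (incident_edges G v)"
  shows "card {e \<in> incident_edges G u. f e = c} \<le> card {e \<in> incident_edges G v. f e = c}"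
proof (cases "u = v")
  case False
  obtain Q where Q: "\<And>e. e \<in> incident_edges G u \<Longrightarrow> path_between G u (Q e) v"
    "\<And>e. e \<in> incident_edges G u \<Longrightarrow> \<forall>e' \<in> path_edges (Q e). f e' = f e"
    "\<And>e e'. e \<in> incident_edges G u \<Longrightarrow> e' \<in> incident_edges G u \<Longrightarrow> e \<noteq> e' \<Longrightarrow>
      disjnt (path_edges (Q e)) (path_edges (Q e'))"
    using MC_coloring_low_degree[OF MC uv False deg] by metis
  have "\<forall>e \<in> incident_edges G u. \<exists>e'. e' \<in> incident_edges G v \<and> e' \<in> path_edges (Q e)"
    using Q(1) False path_between_hits_ends(2) by metis
  then obtain L where L: "\<And>e. e \<in> incident_edges G u \<Longrightarrow> L e \<in> incident_edges G v"
      "\<And>e. e \<in> incident_edges G u \<Longrightarrow> L e \<in> path_edges (Q e)"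
    by metis
  show ?thesis
  proof (rule card_inj_on_le)
    show "inj_on L {e \<in> incident_edges G u. f e = c}"
    proof (rule inj_onI)
      fix e e' assume "e \<in> {e \<in> incident_edges G u. f e = c}"
        "e' \<in> {e \<in> incident_edges G u. f e = c}" "L e = L e'"
      then show "e = e'"
        using Q(3)[of e e'] L(2)[of e] L(2)[of e'] by (auto simp: disjnt_def)
    qed
    show "L ` {e \<in> incident_edges G u. f e = c} \<subseteq> {e \<in> incident_edges G v. f e = c}"
      using L Q(2) by auto
  qed (use fin in simp)
qed simp

section \<open>Colour degrees in complete bipartite graphs and the upper bound\<close>

locale bipartition =
  fixes G :: "('a, 'b) pre_digraph" and U V :: "'a set"
  assumes verts: "verts G = U \<union> V"
    and disjoint: "U \<inter> V = {}"
    and arcs: "arcs_ends G = U \<times> V \<union> V \<times> U"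
    and finite_U: "finite U" and finite_V: "finite V"
begin

lemma uedges_eq: "uedges G = {{a, b} | a b. a \<in> U \<and> b \<in> V}"
  by (auto simp: uedges_def arcs insert_commute)

lemma edge_in_uedges_iff:
  "{x, y} \<in> uedges G \<longleftrightarrow> x \<in> U \<and> y \<in> V \<or> x \<in> V \<and> y \<in> U"
  by (auto simp: uedges_eq doubleton_eq_iff)

lemma incident_edges_V: "b \<in> V \<Longrightarrow> incident_edges G b = (\<lambda>a. {a, b}) ` U"
  using disjoint by (auto simp: incident_edges_def uedges_eq)

lemma card_incident_edges_V:
  assumes "b \<in> V"
  shows "card (incident_edges G b) = card U" "finite (incident_edges G b)"
  using assms disjoint finite_U
  by (auto simp: incident_edges_V doubleton_eq_iff intro!: card_image inj_onI)

lemma color_degree_eq: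
  assumes "MC_coloring (card U) G f" "b \<in> V" "b' \<in> V"
  shows "card {e \<in> incident_edges G b. f e = c} = card {e \<in> incident_edges G b'. f e = c}"
  using assms card_incident_edges_V verts
  by (intro antisym MC_coloring_color_degree_le[OF assms(1)]) auto

text \<open>Equal colour degrees carry a colour from the end of \<open>e\<close> in \<open>V\<close>
  over to \<open>b\<close>; hence all colours can be counted at one vertex.\<close>

lemma color_at_each_V:
  assumes MC: "MC_coloring (card U) G f" and e: "e \<in> uedges G" and b: "b \<in> V"
  shows "f e \<in> f ` incident_edges G b"
proof -
  obtain a' b' where e': "e = {a', b'}" "a' \<in> U" "b' \<in> V"
    using e by (auto simp: uedges_eq)
  then have "e \<in> {e' \<in> incident_edges G b'. f e' = f e}"
    by (auto simp: incident_edges_V)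
  then have "card {e' \<in> incident_edges G b'. f e' = f e} > 0"
    using card_incident_edges_V(2)[OF e'(3)] by (auto simp: card_gt_0_iff)
  then have "card {e' \<in> incident_edges G b. f e' = f e} > 0"
    using color_degree_eq[OF MC b e'(3)] by simp
  then obtain e' where "e' \<in> incident_edges G b" "f e' = f e"
    by (auto simp: card_gt_0_iff)
  then show ?thesis by (metis imageI)
qed

lemma color_degree_neq_1:
  assumes MC: "MC_coloring (card U) G f" and U: "card U \<ge> 2"
    and b: "b \<in> V"
  shows "card {e \<in> incident_edges G b. f e = c} \<noteq> 1"
proof
  assume one: "card {e \<in> incident_edges G b. f e = c} = 1"
  \<comment> \<open>Degree 1 in colour \<open>c\<close> transfers from \<open>b\<close> to every
    vertex of \<open>V\<close>, so none of them has edges of colour \<open>c\<close> to two vertices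
    of \<open>U\<close>.\<close>
  have unique: "a = a'" if "a \<in> U" "a' \<in> U" "b' \<in> V" "f {a, b'} = c" "f {a', b'} = c" for a a' b'
  proof -
    have "card {e \<in> incident_edges G b'. f e = c} = 1"
      using one color_degree_eq[OF MC b that(3)] by simp
    then obtain e where "{e \<in> incident_edges G b'. f e = c} = {e}"
      by (auto simp: card_1_singleton_iff)
    moreover have "{a, b'} \<in> {e \<in> incident_edges G b'. f e = c}"
      "{a', b'} \<in> {e \<in> incident_edges G b'. f e = c}"
      using that by (auto simp: incident_edges_V)
    ultimately have "{a, b'} = {a', b'}" by simp
    then show ?thesis using that disjoint by (auto simp: doubleton_eq_iff)
  qed
  obtain a where a: "a \<in> U" "f {a, b} = c"
  proof -
    have "{e \<in> incident_edges G b. f e = c} \<noteq> {}"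
      using one by (metis card.empty zero_neq_one)
    then show thesis using that b by (auto simp: incident_edges_V)
  qed
  have star: "f {a, b'} = c" if b': "b' \<in> V" "b' \<noteq> b" for b'
  proof -
    have ab: "{a, b} \<in> incident_edges G b" using a b by (simp add: incident_edges_V)
    \<comment> \<open>This is the path indexed by \<open>{a, b}\<close>, hence of colour
      \<open>c\<close>. It will turn out to be \<open>[b, a, b']\<close>.\<close>
    obtain p where p: "path_between G b p b'" "\<forall>e \<in> path_edges p. f e = c"
      using MC_coloring_low_degree[OF MC, of b b'] card_incident_edges_V[OF b] verts a b b' ab
      by (metis UnCI order_refl)
    then have vp: "p \<noteq> []" "hd p = b" "last p = b'" "distinct p" "path_edges p \<subseteq> uedges G"
      using path_edges_subset_uedges by (auto simp: path_between_def vpath_def vwalk_def)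
    then obtain x p' where px: "p = b # x # p'"
      using b' by (cases p rule: vwalk_arcs.cases) auto
    have x: "x \<in> U" "f {b, x} = c"
      using vp px p b disjoint by (auto simp: edge_in_uedges_iff)
    then have "x = a" using unique[of x a b] a b by (simp add: insert_commute)
    moreover have "p' \<noteq> []" using vp px x b' disjoint by auto
    then obtain y q where p': "p' = y # q" by (cases p') auto
    have y: "y \<in> V" "f {x, y} = c"
      using vp px p p' x disjoint by (auto simp: edge_in_uedges_iff)
    \<comment> \<open>Going on beyond \<open>y\<close> would need an edge of colour \<open>c\<close>
      at \<open>y\<close>, but the only one leads back to \<open>x\<close>, which the path has
      already visited.\<close>
    have "q = []"
    proof (rule ccontr)
      assume "q \<noteq> []"
      then obtain z q' where q: "q = z # q'" by (cases q) auto
      have "z \<in> U" "f {y, z} = c"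
        using vp px p p' q y disjoint by (auto simp: edge_in_uedges_iff)
      then have "z = x" using unique[of z x y] x y by (simp add: insert_commute)
      then show False using vp px p' q by simp
    qed
    then have "y = b'" using vp px p' by simp
    ultimately show ?thesis using y by simp
  qed
  have "U \<noteq> {a}" using U by auto
  then obtain a' where a': "a' \<in> U" "a' \<noteq> a" using a by blast
  have "card U > 0" using U by simp
  \<comment> \<open>A single path from \<open>a\<close> to \<open>a'\<close> suffices. All edges at
    \<open>a\<close> have colour \<open>c\<close>, so the path has colour \<open>c\<close>, and its
    edge at \<open>a'\<close> ends in a vertex of \<open>V\<close> that also has an edge of colour
    \<open>c\<close> to \<open>a\<close>, against \<open>unique\<close>.\<close>
  then have "\<exists>P. card P > 0 \<and> (\<forall>p \<in> P. path_between G a p a' \<and> monochromatic f p)"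
    using MC a a' U verts unfolding MC_coloring_def
    by (metis (no_types, lifting) UnCI order_less_le_trans)
  then obtain p where p: "path_between G a p a'" "monochromatic f p"
    by (metis all_not_in_conv card.empty less_irrefl)
  obtain e where e: "e \<in> incident_edges G a" "e \<in> path_edges p"
    using path_between_hits_ends(1)[OF p(1)] a' by auto
  obtain e' where e': "e' \<in> incident_edges G a'" "e' \<in> path_edges p"
    using path_between_hits_ends(2)[OF p(1)] a' by auto
  have "f e = f e'" using p(2) e e' by (auto simp: monochromatic_def)
  moreover have "f e = c"
    using e(1) a star disjoint by (auto simp: incident_edges_def uedges_eq)
  moreover obtain b' where "b' \<in> V" "e' = {a', b'}"
    using e'(1) a' disjoint by (auto simp: incident_edges_def uedges_eq)
  ultimately have "b' \<in> V" "f {a', b'} = c" by simp_all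
  moreover have "f {a, b'} = c"
    using a(2) star[OF \<open>b' \<in> V\<close>] by (cases "b' = b") simp_all
  ultimately show False using unique[of a a' b'] a(1) a' by simp
qed

lemma MC_coloring_card_colors_le:
  assumes MC: "MC_coloring (card U) G f" and U: "card U \<ge> 2" and V: "V \<noteq> {}"
  shows "card (f ` uedges G) \<le> card U div 2"
proof -
  obtain b where b: "b \<in> V" using V by blast
  note fin = card_incident_edges_V(2)[OF b]
  let ?I = "incident_edges G b"
  have sub: "f ` uedges G \<subseteq> f ` ?I"
    using color_at_each_V[OF MC _ b] by blast
  have two: "2 \<le> card {e \<in> ?I. f e = c}" if "c \<in> f ` ?I" for c
  proof -
    have "card {e \<in> ?I. f e = c} \<noteq> 0" using that fin by auto
    then show ?thesis using color_degree_neq_1[OF MC U b, of c] by linarith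
  qed
  \<comment> \<open>The edges at \<open>b\<close> are split into colour classes, each of size at
    least 2; \<open>sum.image_gen\<close> with the constant 1 adds up the class sizes.\<close>
  have "2 * card (f ` ?I) = (\<Sum>c \<in> f ` ?I. 2)" by simp
  also have "\<dots> \<le> (\<Sum>c \<in> f ` ?I. card {e \<in> ?I. f e = c})"
    using two by (intro sum_mono) auto
  also have "\<dots> = card ?I"
    using sum.image_gen[OF fin, of "\<lambda>_. 1 :: nat" f] by simp
  also have "\<dots> = card U" using card_incident_edges_V(1)[OF b] .
  finally have "card (f ` ?I) \<le> card U div 2" by simp
  moreover have "card (f ` uedges G) \<le> card (f ` ?I)"
    using sub fin by (intro card_mono) auto
  ultimately show ?thesis by simp
qed

section \<open>Edge-disjoint paths and the constant colouring\<close>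

lemma disjoint_paths_V:
  assumes "u \<in> V" "v \<in> V" "u \<noteq> v"
  shows "\<exists>P. finite P \<and> card P = card U \<and> (\<forall>p \<in> P. path_between G u p v) \<and>
    pairwise (\<lambda>p q. disjnt (path_edges p) (path_edges q)) P"
proof (intro exI conjI)
  let ?P = "(\<lambda>a. [u, a, v]) ` U"
  show "card ?P = card U" by (intro card_image inj_onI) simp
  show "\<forall>p \<in> ?P. path_between G u p v"
    using assms disjoint by (auto simp: path_between_def vpath_def vwalk_def verts arcs)
  show "pairwise (\<lambda>p q. disjnt (path_edges p) (path_edges q)) ?P"
    using assms disjoint by (auto simp: pairwise_def disjnt_def doubleton_eq_iff)
qed (use finite_U in simp)

lemma disjoint_paths_UV:
  assumes uv: "u \<in> U" "v \<in> V" and le: "card U \<le> card V"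
  shows "\<exists>P. finite P \<and> card P = card U \<and> (\<forall>p \<in> P. path_between G u p v) \<and>
    pairwise (\<lambda>p q. disjnt (path_edges p) (path_edges q)) P"
proof -
  \<comment> \<open>Besides the edge from \<open>u\<close> to \<open>v\<close> there is one path of
    length 3 for each further \<open>a\<close> in \<open>U\<close>. Its first inner vertex
    \<open>g a\<close> must be new for each \<open>a\<close> and different from \<open>v\<close>,
    which is where the sizes of the sides matter.\<close>
  have "card (U - {u}) \<le> card (V - {v})"
    using uv le finite_U finite_V by simp
  then obtain g where g: "g ` (U - {u}) \<subseteq> V - {v}" "inj_on g (U - {u})"
    using card_le_inj[of "U - {u}" "V - {v}"] finite_U finite_V by auto
  have g': "g a \<in> V" "g a \<noteq> v" "g a \<noteq> a" if "a \<in> U" "a \<noteq> u" for a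
  proof -
    have "g a \<in> V - {v}" using g(1) that by blast
    then show "g a \<in> V" "g a \<noteq> v" "g a \<noteq> a" using that disjoint by auto
  qed
  let ?Q = "(\<lambda>a. [u, g a, a, v]) ` (U - {u})"
  show ?thesis
  proof (intro exI conjI)
    have "card ?Q = card (U - {u})" by (intro card_image inj_onI) simp
    moreover have "[u, v] \<notin> ?Q" by auto
    ultimately show "card (insert [u, v] ?Q) = card U"
      using card.remove[OF finite_U uv(1)] finite_U by simp
    show "\<forall>p \<in> insert [u, v] ?Q. path_between G u p v"
      using uv g' disjoint by (auto simp: path_between_def vpath_def vwalk_def verts arcs)
    show "pairwise (\<lambda>p q. disjnt (path_edges p) (path_edges q)) (insert [u, v] ?Q)"
      using uv g(2) g' disjoint
      by (auto simp: pairwise_def disjnt_def doubleton_eq_iff dest: inj_onD)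
  qed (use finite_U in simp)
qed

lemma disjoint_paths_VU:
  assumes uv: "u \<in> V" "v \<in> U" and le: "card U \<le> card V"
  shows "\<exists>P. finite P \<and> card P = card U \<and> (\<forall>p \<in> P. path_between G u p v) \<and>
    pairwise (\<lambda>p q. disjnt (path_edges p) (path_edges q)) P"
proof -
  obtain P where P: "finite P" "card P = card U" "\<forall>p \<in> P. path_between G v p u"
    "pairwise (\<lambda>p q. disjnt (path_edges p) (path_edges q)) P"
    using disjoint_paths_UV[OF uv(2,1) le] by blast
  have "symmetric G" by (auto simp: symmetric_def sym_def arcs)
  show ?thesis
  proof (intro exI conjI)
    show "card (rev ` P) = card U" using P(2) by (simp add: card_image)
    show "\<forall>p \<in> rev ` P. path_between G u p v"
      using P(3) vwalk_rev_ex[OF \<open>symmetric G\<close>]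
      by (auto simp: path_between_def vpath_def vwalk_def hd_rev last_rev)
    show "pairwise (\<lambda>p q. disjnt (path_edges p) (path_edges q)) (rev ` P)"
      using P(4) by (auto simp: pairwise_def)
  qed (use P(1) in simp)
qed

text \<open>This guarantees that \<open>mc\<close> is the maximum of a nonempty set; without any
  such colouring its value would be unspecified and no bound could follow.\<close>

lemma MC_coloring_constant:
  assumes le: "card U \<le> card V"
  shows "MC_coloring (card U) G (\<lambda>_. c)"
  unfolding MC_coloring_def
proof (intro ballI impI)
  fix u v assume uv: "u \<in> verts G" "v \<in> verts G" "u \<noteq> v"
  \<comment> \<open>With the sides exchanged, two vertices of \<open>U\<close> are joined by
    \<open>card V\<close> paths, one through each vertex of \<open>V\<close>, and this is at least
    \<open>card U\<close>.\<close>
  interpret swapped: bipartition G V U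
    using verts disjoint arcs finite_U finite_V by unfold_locales auto
  have "\<exists>P. finite P \<and> card P \<ge> card U \<and> (\<forall>p \<in> P. path_between G u p v) \<and>
      pairwise (\<lambda>p q. disjnt (path_edges p) (path_edges q)) P"
  proof -
    consider "u \<in> V" "v \<in> V" | "u \<in> U" "v \<in> U" | "u \<in> U" "v \<in> V" | "u \<in> V" "v \<in> U"
      using uv verts by auto
    then show ?thesis
    proof cases
      case 1
      then show ?thesis using disjoint_paths_V uv(3) by (metis order_refl)
    next
      case 2
      then show ?thesis using swapped.disjoint_paths_V uv(3) le by metis
    next
      case 3
      then show ?thesis using disjoint_paths_UV le by (metis order_refl)
    next
      case 4
      then show ?thesis using disjoint_paths_VU le by (metis order_refl)
    qed
  qed
  moreover have "monochromatic (\<lambda>_. c) p" for p :: "'a vwalk"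
    by (simp add: monochromatic_def)
  ultimately show "\<exists>P. finite P \<and> card U \<le> card P \<and>
      (\<forall>p \<in> P. path_between G u p v \<and> monochromatic (\<lambda>_. c) p) \<and>
      pairwise (\<lambda>p q. disjnt (path_edges p) (path_edges q)) P"
    by metis
qed

end

theorem theorem2p15:
  fixes k n :: nat and G :: "('a, 'b) pre_digraph"
  assumes "n \<ge> k" and "k \<ge> 3"
    and "K\<^bsub>k,n\<^esub> G"
  shows "mc k G \<le> k div 2"
proof -
  obtain U V where UV: "verts G = U \<union> V" "U \<inter> V = {}" "arcs_ends G = U \<times> V \<union> V \<times> U"
      "card U = k" "card V = n"
    using assms(3) by (auto simp: complete_bipartite_digraph_def)
  \<comment> \<open>Infinite sets have cardinality 0, so positivity yields the finiteness of both
    sides.\<close>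
  have pos: "card U > 0" "card V > 0" using UV assms by auto
  then interpret bipartition G U V
    using UV by unfold_locales (auto intro: card_ge_0_finite)
  let ?S = "{card (f ` uedges G) | f. MC_coloring k G f}"
  have bound: "m \<le> k div 2" if m: "m \<in> ?S" for m
  proof -
    obtain f where f: "MC_coloring (card U) G f" "m = card (f ` uedges G)"
      using m UV(4) by auto
    have "card U \<ge> 2" "V \<noteq> {}" using UV(4) assms(2) pos by auto
    then show ?thesis using MC_coloring_card_colors_le[OF f(1)] f(2) UV(4) by simp
  qed
  \<comment> \<open>A bounded set of natural numbers is finite, so the bound itself makes
    \<open>Max\<close> meaningful, together with the constant colouring as a member.\<close>
  then have "finite ?S" by (meson finite_nat_set_iff_bounded_le)
  moreover have "?S \<noteq> {}" using MC_coloring_constant UV assms by auto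
  ultimately have "Max ?S \<le> k div 2" using bound by simp
  then show ?thesis by (simp add: mc_def)
qed

end
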